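(* The map $\mathrm{rp}:\mathrm{RGF}_n\to \mathrm{Av}_n(P_3)$ is a bijection with inverse $\mathrm{rp}^{-1}$. Thus $|\mathrm{Av}_n(P_3)|=B_n$, the $n$th Bell number.
   Context: Restricted growth functions. A restricted growth function (RGF) of length $n$ is a sequence of nonnegative integers $\rho=r_1r_2\ldots r_n$ with $r_1=0$ and $r_{k+1}\le 1+\max\rho_k$ for $k\in\{1,\dots,n-1\}$, where $\rho_k=r_1\ldots r_k$ and $\max\rho_k$ is the largest entry of $\rho_k$. $\mathrm{RGF}_n$ is the set of RGFs of length $n$. Posets. A poset $P$ on $[n]=\{1,\dots,n\}$ with strict order $<_P$ is factorial if for all $i,j,k\in[n]$: $i<j$ (as integers) and $j<_Pk$ imply $i<_Pk$. A special $P_3$ in $P$ is an induced subposet on elements $j,\ j+1,\ k$ with $j+1<k$, $j<_Pk$, and $j+1$ incomparable in $P$ to both $j$ and $k$. $\mathrm{Av}_n(P_3)$ is the set of factorial posets on $[n]$ containing no special $P_3$. The map $\mathrm{rp}$. For $\rho=r_1\ldots r_n\in \mathrm{RGF}_n$, $P=\mathrm{rp}(\rho)$ is the poset on $[n]$ defined by $i<_Pj$ if and only if $\max\rho_i<r_j$. The map $\mathrm{rp}^{-1}$. For $P\in \mathrm{Av}_n(P_3)$ and $k\in[n]$ not minimal in $P$, let $M(k)=\max\{i\in P: i<_Pk\}$, the maximum being taken in the integers (one has $M(k)<k$). Then $\mathrm{rp}^{-1}(P)$ is the sequence $\rho=r_1\ldots r_n$ defined recursively by $r_k=0$ if $k$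 is minimal in $P$, and $r_k=\max\rho_{M(k)}+1$ otherwise. *)

theory Defs
  imports Main "HOL-Library.Disjoint_Sets"
begin

text \<open>
  Sequences \<open>r\<^sub>1 \<dots> r\<^sub>n\<close> are lists, accessed through 1-based indices \<open>k \<in> {1..n}\<close>.
  \<open>max_prefix \<rho> k\<close> is meaningful only for \<open>k \<ge> 1\<close>.
\<close>

definition entry :: "nat list \<Rightarrow> nat \<Rightarrow> nat" where
  "entry \<rho> k = \<rho> ! (k - 1)"

definition max_prefix :: "nat list \<Rightarrow> nat \<Rightarrow> nat" where
  "max_prefix \<rho> k = Max (set (take k \<rho>))"

text \<open>For \<open>n = 0\<close> the only restricted growth function is the empty one.\<close>

definition RGF :: "nat \<Rightarrow> nat list set" where
  "RGF n = {\<rho>. length \<rho> = n \<and> (n \<ge> 1 \<longrightarrow> entry \<rho> 1 = 0) \<and>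
     (\<forall>k. 1 \<le> k \<and> k < n \<longrightarrow> entry \<rho> (k + 1) \<le> 1 + max_prefix \<rho> k)}"

text \<open>
  A poset on \<open>[n]\<close> is represented by its strict order: \<open>(i, j) \<in> P\<close> means \<open>i <\<^sub>P j\<close>.
\<close>

definition poset_on :: "nat \<Rightarrow> (nat \<times> nat) set \<Rightarrow> bool" where
  "poset_on n P \<longleftrightarrow> P \<subseteq> {1..n} \<times> {1..n} \<and> irrefl P \<and> trans P"

definition factorial_poset :: "nat \<Rightarrow> (nat \<times> nat) set \<Rightarrow> bool" where
  "factorial_poset n P \<longleftrightarrow> poset_on n P \<and>
     (\<forall>i\<in>{1..n}. \<forall>j\<in>{1..n}. \<forall>k\<in>{1..n}. i < j \<and> (j, k) \<in> P \<longrightarrow> (i, k) \<in> P)"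

definition incomparable :: "(nat \<times> nat) set \<Rightarrow> nat \<Rightarrow> nat \<Rightarrow> bool" where
  "incomparable P a b \<longleftrightarrow> a \<noteq> b \<and> (a, b) \<notin> P \<and> (b, a) \<notin> P"

definition has_special_P3 :: "nat \<Rightarrow> (nat \<times> nat) set \<Rightarrow> bool" where
  "has_special_P3 n P \<longleftrightarrow>
     (\<exists>j k. j \<in> {1..n} \<and> j + 1 \<in> {1..n} \<and> k \<in> {1..n} \<and> j + 1 < k \<and> (j, k) \<in> P \<and>
        incomparable P (j + 1) j \<and> incomparable P (j + 1) k)"

definition Av_P3 :: "nat \<Rightarrow> (nat \<times> nat) set set" where
  "Av_P3 n = {P. factorial_poset n P \<and> \<not> has_special_P3 n P}"

definition rp :: "nat list \<Rightarrow> (nat \<times> nat) set" where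
  "rp \<rho> = {(i, j). i \<in> {1..length \<rho>} \<and> j \<in> {1..length \<rho>} \<and> max_prefix \<rho> i < entry \<rho> j}"

definition minimal_in :: "(nat \<times> nat) set \<Rightarrow> nat \<Rightarrow> bool" where
  "minimal_in P k \<longleftrightarrow> (\<nexists>i. (i, k) \<in> P)"

definition max_below :: "(nat \<times> nat) set \<Rightarrow> nat \<Rightarrow> nat" where
  "max_below P k = Max {i. (i, k) \<in> P}"

text \<open>
  \<open>rp_inv n P\<close> computes \<open>r\<^sub>1 \<dots> r\<^sub>n\<close> from left to right, so the sequence for \<open>P\<close> is
  extended by its \<open>k\<close>-th entry, \<open>k = Suc m\<close>, once \<open>r\<^sub>1 \<dots> r\<^sub>m\<close> is known. This suffices since
  \<open>max_below P k \<le> m\<close> whenever \<open>P\<close> is factorial and \<open>k\<close> is not minimal.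
\<close>

primrec rp_inv :: "nat \<Rightarrow> (nat \<times> nat) set \<Rightarrow> nat list" where
  "rp_inv 0 P = []"
| "rp_inv (Suc m) P =
     rp_inv m P @ [if minimal_in P (Suc m) then 0
                   else max_prefix (rp_inv m P) (max_below P (Suc m)) + 1]"

definition Bell :: "nat \<Rightarrow> nat" where
  "Bell n = card {\<A>. partition_on {1..n} \<A>}"

end

theory Submission
  imports Defs
begin

text \<open>
  Write \<open>M\<^sub>i\<close> for the maximum of the first \<open>i\<close> entries of a restricted growth function. The sequence
  \<open>M\<close> is weakly increasing, starts at \<open>0\<close>, and grows by at most one per step; everything about
  the map \<open>rp\<close> follows from this.

  Since \<open>r\<^sub>j \<le> M\<^sub>j\<close>, the relation \<open>M\<^sub>i < r\<^sub>j\<close> forces \<open>i < j\<close> and is transitive, and monotonicity of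
  \<open>M\<close> makes it factorial. A special \<open>P\<^sub>3\<close> on \<open>j, j + 1, k\<close> would need \<open>M\<^sub>j < r\<^sub>k \<le> M\<^bsub>j+1\<^esub>\<close> although
  \<open>r\<^bsub>j+1\<^esub> \<le> M\<^sub>j\<close> (\<open>rp_in_Av_P3\<close>).

  To recover \<open>r\<^sub>k\<close> from the poset, take the largest \<open>i\<close> below \<open>k\<close>: then \<open>M\<^sub>i < r\<^sub>k \<le> M\<^bsub>i+1\<^esub> \<le> M\<^sub>i + 1\<close>,
  so \<open>r\<^sub>k = M\<^sub>i + 1\<close>, which is the recursion defining \<open>rp_inv\<close> (\<open>rp_inv_rp\<close>).

  Conversely let \<open>\<rho>\<close> be built from a poset by that recursion. By factoriality, \<open>i <\<^sub>P k\<close> just says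
  that \<open>i\<close> is at most the largest element \<open>m\<close> below \<open>k\<close>, and this gives \<open>M\<^sub>i \<le> M\<^sub>m < r\<^sub>k\<close>. The converse
  could fail only if \<open>M\<close> did not grow immediately after \<open>m\<close>; but then \<open>m, m + 1, k\<close> is a special
  \<open>P\<^sub>3\<close> (\<open>rp_rp_inv\<close>).

  For the enumeration, a restricted growth function is determined by the partition of its
  positions into sets of equal entries: reading from left to right, a position opening a new
  block must receive the least unused value. Every partition occurs, by numbering its blocks in
  the order of their minima (\<open>bij_betw_fibres\<close>).
\<close>

section \<open>Prefix maxima\<close>

lemma set_take_eq_entries:
  assumes "k \<le> length \<rho>"
  shows "set (take k \<rho>) = entry \<rho> ` {1..k}"
proof -
  have "set (take k \<rho>) = (!) \<rho> ` {..<k}"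
    using assms by (simp add: nth_image lessThan_atLeast0)
  also have "\<dots> = (\<lambda>i. entry \<rho> (Suc i)) ` {..<k}"
    by (simp add: entry_def)
  also have "\<dots> = entry \<rho> ` {1..k}"
    using image_Suc_lessThan[of k] by (simp flip: image_image)
  finally show ?thesis .
qed

lemma entry_le_max_prefix:
  assumes "1 \<le> i" "i \<le> k" "k \<le> length \<rho>"
  shows "entry \<rho> i \<le> max_prefix \<rho> k"
  using assms by (simp add: max_prefix_def set_take_eq_entries)

lemma max_prefix_attained:
  assumes "1 \<le> k" "k \<le> length \<rho>"
  obtains i where "1 \<le> i" "i \<le> k" "entry \<rho> i = max_prefix \<rho> k"
proof -
  have "max_prefix \<rho> k \<in> entry \<rho> ` {1..k}"
    unfolding max_prefix_def set_take_eq_entries[OF assms(2)]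
    using assms(1) by (intro Max_in) auto
  then show thesis using that by auto
qed

lemma max_prefix_mono:
  assumes "1 \<le> i" "i \<le> k" "k \<le> length \<rho>"
  shows "max_prefix \<rho> i \<le> max_prefix \<rho> k"
proof -
  obtain j where "1 \<le> j" "j \<le> i" "entry \<rho> j = max_prefix \<rho> i"
    using max_prefix_attained[of i \<rho>] assms by auto
  then show ?thesis using entry_le_max_prefix[of j k \<rho>] assms by simp
qed

lemma max_prefix_Suc:
  assumes "1 \<le> k" "k < length \<rho>"
  shows "max_prefix \<rho> (Suc k) = max (max_prefix \<rho> k) (entry \<rho> (Suc k))"
  using assms by (simp add: max_prefix_def set_take_eq_entries atLeastAtMostSuc_conv max.commute)

lemma max_prefix_take:
  "i \<le> m \<Longrightarrow> max_prefix (take m \<rho>) i = max_prefix \<rho> i"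
  by (simp add: max_prefix_def min_absorb1)

lemma entry_take:
  "1 \<le> i \<Longrightarrow> i \<le> m \<Longrightarrow> entry (take m \<rho>) i = entry \<rho> i"
  by (simp add: entry_def)

lemma list_eqI_entries:
  assumes "length \<rho> = length \<sigma>" "\<And>k. 1 \<le> k \<Longrightarrow> k \<le> length \<rho> \<Longrightarrow> entry \<rho> k = entry \<sigma> k"
  shows "\<rho> = \<sigma>"
proof (rule nth_equalityI[OF assms(1)])
  fix i assume "i < length \<rho>"
  then show "\<rho> ! i = \<sigma> ! i" using assms(2)[of "Suc i"] by (simp add: entry_def)
qed

lemma RGF_D:
  assumes "\<rho> \<in> RGF n"
  shows RGF_length: "length \<rho> = n"
    and RGF_first: "n \<ge> 1 \<Longrightarrow> entry \<rho> 1 = 0"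
    and RGF_step: "1 \<le> k \<Longrightarrow> k < n \<Longrightarrow> entry \<rho> (Suc k) \<le> Suc (max_prefix \<rho> k)"
  using assms by (auto simp: RGF_def)

lemma RGF_max_prefix_1:
  assumes "\<rho> \<in> RGF n" "n \<ge> 1"
  shows "max_prefix \<rho> 1 = 0"
  using max_prefix_attained[of 1 \<rho>] RGF_D[OF assms(1)] assms(2) by (metis le_antisym order_refl)

lemma RGF_max_prefix_Suc_le:
  assumes "\<rho> \<in> RGF n" "1 \<le> k" "k < n"
  shows "max_prefix \<rho> (Suc k) \<le> Suc (max_prefix \<rho> k)"
  using RGF_D[OF assms(1)] assms max_prefix_Suc[of k \<rho>] by simp

text \<open>Prefix maxima start at \<open>0\<close> and never jump, so no value below the current maximum is skipped.\<close>

lemma RGF_value_occurs: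
  assumes "\<rho> \<in> RGF n" "1 \<le> k" "k \<le> n" "v \<le> max_prefix \<rho> k"
  shows "\<exists>j. 1 \<le> j \<and> j \<le> k \<and> entry \<rho> j = v"
  using assms(2-4)
proof (induction k rule: dec_induct)
  case base
  then show ?case using RGF_max_prefix_1[OF assms(1)] RGF_first[OF assms(1)] by auto
next
  case (step k)
  show ?case
  proof (cases "v \<le> max_prefix \<rho> k")
    case True
    then show ?thesis using step by (metis Suc_leD le_SucI)
  next
    case False
    then have "v = entry \<rho> (Suc k)"
      using step.prems step.hyps max_prefix_Suc[of k \<rho>] RGF_length[OF assms(1)]
        RGF_step[OF assms(1), of k] by simp
    then show ?thesis by auto
  qed
qed

section \<open>From restricted growth functions to posets\<close>

lemma in_rp_iff:
  "(i, j) \<in> rp \<rho> \<longleftrightarrow>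
     1 \<le> i \<and> i \<le> length \<rho> \<and> 1 \<le> j \<and> j \<le> length \<rho> \<and> max_prefix \<rho> i < entry \<rho> j"
  by (auto simp: rp_def)

lemma rp_natural:
  assumes "(i, j) \<in> rp \<rho>"
  shows "i < j"
proof (rule ccontr)
  assume "\<not> i < j"
  then have "entry \<rho> j \<le> max_prefix \<rho> i"
    using assms by (intro entry_le_max_prefix) (auto simp: in_rp_iff)
  then show False using assms by (simp add: in_rp_iff)
qed

lemma rp_trans: "trans (rp \<rho>)"
proof (rule transI)
  fix i j k assume "(i, j) \<in> rp \<rho>" "(j, k) \<in> rp \<rho>"
  then show "(i, k) \<in> rp \<rho>"
    using entry_le_max_prefix[of j j \<rho>] by (auto simp: in_rp_iff)
qed

text \<open>
  If \<open>j\<close> lies below \<open>k\<close> but \<open>j + 1\<close> does not, the prefix maximum increases at \<open>j + 1\<close>. It can do so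
  only because the entry there exceeds the prefix maximum at \<open>j\<close>, which puts \<open>j\<close> below \<open>j + 1\<close>.
\<close>

lemma rp_in_Av_P3: "rp \<rho> \<in> Av_P3 (length \<rho>)"
proof -
  have "poset_on (length \<rho>) (rp \<rho>)"
    unfolding poset_on_def irrefl_def using rp_natural[of _ _ \<rho>] rp_trans
    by (auto simp: in_rp_iff)
  moreover have "(i, k) \<in> rp \<rho>" if "1 \<le> i" "i < j" "(j, k) \<in> rp \<rho>" for i j k
    using that max_prefix_mono[of i j \<rho>] by (auto simp: in_rp_iff)
  moreover have False
    if "j + 1 \<le> length \<rho>" and less: "(j, k) \<in> rp \<rho>"
      and inc: "(j, j + 1) \<notin> rp \<rho>" "(j + 1, k) \<notin> rp \<rho>" for j k
  proof -
    have "entry \<rho> (Suc j) \<le> max_prefix \<rho> j" "entry \<rho> k \<le> max_prefix \<rho> (Suc j)"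
      using that by (auto simp: in_rp_iff)
    then show False using less that(1) max_prefix_Suc[of j \<rho>] by (simp add: in_rp_iff)
  qed
  ultimately show ?thesis
    unfolding Av_P3_def factorial_poset_def has_special_P3_def incomparable_def
      atLeastAtMost_iff mem_Collect_eq Ball_def
    by blast
qed

section \<open>Recovering the sequence\<close>

lemma length_rp_inv [simp]: "length (rp_inv m P) = m"
  by (induction m) auto

lemma finite_below:
  assumes "poset_on n P"
  shows "finite {i. (i, k) \<in> P}"
  by (rule finite_subset[of _ "{1..n}"]) (use assms in \<open>auto simp: poset_on_def\<close>)

lemma max_below_in:
  assumes "poset_on n P" "\<not> minimal_in P k"
  shows "(max_below P k, k) \<in> P"
  using Max_in[OF finite_below[OF assms(1), of k]] assms(2)
  by (auto simp: max_below_def minimal_in_def)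

lemma le_max_below:
  assumes "poset_on n P" "(i, k) \<in> P"
  shows "i \<le> max_below P k"
  using Max_ge[OF finite_below[OF assms(1), of k]] assms(2) by (simp add: max_below_def)

lemma factorial_poset_imp_poset_on: "factorial_poset n P \<Longrightarrow> poset_on n P"
  by (simp add: factorial_poset_def)

lemma factorial_poset_range:
  assumes "factorial_poset n P" "(i, k) \<in> P"
  shows "1 \<le> i \<and> i \<le> n \<and> 1 \<le> k \<and> k \<le> n"
proof -
  have "(i, k) \<in> {1..n} \<times> {1..n}"
    using factorial_poset_imp_poset_on[OF assms(1)] assms(2) unfolding poset_on_def by blast
  then show ?thesis by simp
qed

lemma factorial_poset_down_closed:
  assumes "factorial_poset n P" "(j, k) \<in> P" "1 \<le> i" "i \<le> j"
  shows "(i, k) \<in> P"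
proof (cases "i = j")
  case False
  then have "i < j" "i \<in> {1..n}" "j \<in> {1..n}" "k \<in> {1..n}"
    using factorial_poset_range[OF assms(1,2)] assms(3,4) by auto
  then show ?thesis using assms(1,2) unfolding factorial_poset_def by blast
qed (use assms(2) in simp)

lemma factorial_poset_natural:
  assumes "factorial_poset n P" "(i, k) \<in> P"
  shows "i < k"
proof (rule ccontr)
  assume "\<not> i < k"
  then have "(k, k) \<in> P"
    using factorial_poset_range[OF assms] by (intro factorial_poset_down_closed[OF assms]) auto
  moreover have "irrefl P"
    using factorial_poset_imp_poset_on[OF assms(1)] by (simp add: poset_on_def)
  ultimately show False by (simp add: irrefl_def)
qed

lemma factorial_poset_iff_le_max_below:
  assumes "factorial_poset n P" "\<not> minimal_in P k" "1 \<le> i"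
  shows "(i, k) \<in> P \<longleftrightarrow> i \<le> max_below P k"
  using le_max_below[OF factorial_poset_imp_poset_on[OF assms(1)]]
    factorial_poset_down_closed[OF assms(1) max_below_in assms(3)]
    factorial_poset_imp_poset_on[OF assms(1)] assms(2) by blast

lemma rp_inv_rp:
  assumes "\<rho> \<in> RGF n"
  shows "rp_inv n (rp \<rho>) = \<rho>"
proof -
  note [simp] = RGF_length[OF assms]
  have poset: "poset_on n (rp \<rho>)"
    using rp_in_Av_P3[of \<rho>] by (simp add: Av_P3_def factorial_poset_def)
  have "rp_inv m (rp \<rho>) = take m \<rho>" if "m \<le> n" for m
    using that
  proof (induction m)
    case (Suc m)
    define r where "r = entry \<rho> (Suc m)"
    have "(if minimal_in (rp \<rho>) (Suc m) then 0
           else max_prefix (take m \<rho>) (max_below (rp \<rho>) (Suc m)) + 1) = r"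
    proof (cases "minimal_in (rp \<rho>) (Suc m)")
      case True
      then have "(1, Suc m) \<notin> rp \<rho>" by (auto simp: minimal_in_def)
      then show ?thesis
        using True Suc.prems RGF_max_prefix_1[OF assms] by (simp add: in_rp_iff r_def)
    next
      case False
      define i where "i = max_below (rp \<rho>) (Suc m)"
      have i: "(i, Suc m) \<in> rp \<rho>" unfolding i_def by (rule max_below_in[OF poset False])
      have "i \<le> m" using rp_natural[OF i] by simp
      have "(Suc i, Suc m) \<notin> rp \<rho>" using le_max_below[OF poset] unfolding i_def by force
      then have "r \<le> max_prefix \<rho> (Suc i)"
        using \<open>i \<le> m\<close> Suc.prems by (simp add: in_rp_iff r_def)
      also have "\<dots> \<le> Suc (max_prefix \<rho> i)"
        using i \<open>i \<le> m\<close> Suc.prems by (intro RGF_max_prefix_Suc_le[OF assms]) (auto simp: in_rp_iff)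
      finally have "r = Suc (max_prefix \<rho> i)" using i by (simp add: in_rp_iff r_def)
      then show ?thesis using False \<open>i \<le> m\<close> by (simp add: max_prefix_take flip: i_def)
    qed
    then show ?case
      using Suc by (auto simp: take_Suc_conv_app_nth r_def entry_def split: if_splits)
  qed simp
  from this[of n] show ?thesis by simp
qed

section \<open>From posets to restricted growth functions\<close>

lemma take_rp_inv:
  assumes "m \<le> n"
  shows "take m (rp_inv n P) = rp_inv m P"
  using assms by (induction n rule: dec_induct) auto

lemma entry_rp_inv:
  assumes "factorial_poset n P" "1 \<le> k" "k \<le> n"
  shows "entry (rp_inv n P) k =
    (if minimal_in P k then 0 else Suc (max_prefix (rp_inv n P) (max_below P k)))"
proof -
  obtain m where k: "k = Suc m" using assms(2) by (cases k) auto
  have "entry (rp_inv n P) k = entry (rp_inv k P) k"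
    using assms entry_take[of k k "rp_inv n P"] by (simp add: take_rp_inv)
  also have "\<dots> = (if minimal_in P k then 0 else Suc (max_prefix (rp_inv m P) (max_below P k)))"
    unfolding k by (simp add: entry_def nth_append)
  also have "\<dots> = (if minimal_in P k then 0 else Suc (max_prefix (rp_inv n P) (max_below P k)))"
  proof (cases "minimal_in P k")
    case False
    have "(max_below P k, k) \<in> P"
      by (intro max_below_in[OF factorial_poset_imp_poset_on[OF assms(1)] False])
    then have "max_below P k \<le> m" using factorial_poset_natural[OF assms(1)] k by fastforce
    then show ?thesis
      using assms(3) k max_prefix_take[of "max_below P k" m "rp_inv n P"] by (simp add: take_rp_inv)
  qed simp
  finally show ?thesis .
qed

lemma max_below_range:
  assumes "factorial_poset n P" "\<not> minimal_in P k"
  shows "1 \<le> max_below P k" "max_below P k < k" "k \<le> n"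
proof -
  have "(max_below P k, k) \<in> P"
    by (intro max_below_in[OF factorial_poset_imp_poset_on[OF assms(1)] assms(2)])
  then show "1 \<le> max_below P k" "max_below P k < k" "k \<le> n"
    using factorial_poset_natural[OF assms(1)] factorial_poset_range[OF assms(1)] by blast+
qed

lemma rp_inv_in_RGF:
  assumes "factorial_poset n P"
  shows "rp_inv n P \<in> RGF n"
proof -
  have "entry (rp_inv n P) 1 = 0" if "n \<ge> 1"
    using that max_below_range[OF assms, of 1] by (auto simp: entry_rp_inv[OF assms])
  moreover have "entry (rp_inv n P) (k + 1) \<le> 1 + max_prefix (rp_inv n P) k"
    if "1 \<le> k" "k < n" for k
    using that max_below_range[OF assms, of "Suc k"]
    by (auto simp: entry_rp_inv[OF assms] intro!: max_prefix_mono)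
  ultimately show ?thesis by (auto simp: RGF_def)
qed

text \<open>
  Avoidance of special \<open>P\<^sub>3\<close>s is what makes prefix maxima jump right after the largest element
  below \<open>k\<close>; otherwise that element, its successor and \<open>k\<close> would form a special \<open>P\<^sub>3\<close>.
\<close>

lemma max_prefix_jumps_after_max_below:
  assumes "P \<in> Av_P3 n" "\<not> minimal_in P k"
  defines "m \<equiv> max_below P k"
  shows "entry (rp_inv n P) k \<le> max_prefix (rp_inv n P) (Suc m)"
proof -
  let ?\<rho> = "rp_inv n P"
  have fact: "factorial_poset n P" and av: "\<not> has_special_P3 n P"
    using assms(1) by (simp_all add: Av_P3_def)
  have poset: "poset_on n P" by (rule factorial_poset_imp_poset_on[OF fact])
  have m: "1 \<le> m" "m < k" "k \<le> n" unfolding m_def by (rule max_below_range[OF fact assms(2)])+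
  have mk: "(m, k) \<in> P" unfolding m_def by (rule max_below_in[OF poset assms(2)])
  have rk: "entry ?\<rho> k = Suc (max_prefix ?\<rho> m)"
    using m assms(2) by (simp add: entry_rp_inv[OF fact] m_def)
  show ?thesis
  proof (cases "Suc m = k")
    case True
    then show ?thesis using m by (intro entry_le_max_prefix) auto
  next
    case False
    have "(Suc m, k) \<notin> P" using le_max_below[OF poset] unfolding m_def by force
    moreover have "(Suc m, m) \<notin> P" "(k, Suc m) \<notin> P"
      using factorial_poset_natural[OF fact] m by fastforce+
    ultimately have "has_special_P3 n P" if "(m, Suc m) \<notin> P"
      using that m False mk unfolding has_special_P3_def incomparable_def
      by (intro exI[of _ m] exI[of _ k]) auto
    then have less: "(m, Suc m) \<in> P" using av by blast
    then have nmin: "\<not> minimal_in P (Suc m)" by (auto simp: minimal_in_def)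
    then have "max_below P (Suc m) = m"
      using le_max_below[OF poset less] max_below_range(2)[OF fact nmin] by simp
    then have "entry ?\<rho> (Suc m) = entry ?\<rho> k"
      using nmin m rk by (simp add: entry_rp_inv[OF fact])
    then show ?thesis using entry_le_max_prefix[of "Suc m" "Suc m" ?\<rho>] m by simp
  qed
qed

lemma rp_rp_inv:
  assumes "P \<in> Av_P3 n"
  shows "rp (rp_inv n P) = P"
proof -
  let ?\<rho> = "rp_inv n P"
  have fact: "factorial_poset n P" using assms by (simp add: Av_P3_def)
  have poset: "poset_on n P" by (rule factorial_poset_imp_poset_on[OF fact])
  have "max_prefix ?\<rho> i < entry ?\<rho> k \<longleftrightarrow> (i, k) \<in> P"
    if ik: "1 \<le> i" "i \<le> n" "1 \<le> k" "k \<le> n" for i k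
  proof (cases "minimal_in P k")
    case True
    then show ?thesis using ik by (simp add: entry_rp_inv[OF fact]) (simp add: minimal_in_def)
  next
    case False
    define m where "m = max_below P k"
    have m: "1 \<le> m" "m < k" unfolding m_def by (rule max_below_range[OF fact False])+
    have rk: "entry ?\<rho> k = Suc (max_prefix ?\<rho> m)"
      using ik False by (simp add: entry_rp_inv[OF fact] m_def)
    show ?thesis
    proof (cases "i \<le> m")
      case True
      then show ?thesis
        using factorial_poset_iff_le_max_below[OF fact False ik(1)] max_prefix_mono[of i m ?\<rho>]
          ik m rk by (simp add: m_def)
    next
      case gt: False
      have "entry ?\<rho> k \<le> max_prefix ?\<rho> (Suc m)"
        unfolding m_def by (rule max_prefix_jumps_after_max_below[OF assms False])
      also have "\<dots> \<le> max_prefix ?\<rho> i" using gt ik by (intro max_prefix_mono) auto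
      finally show ?thesis
        using gt factorial_poset_iff_le_max_below[OF fact False ik(1)] by (simp add: m_def)
    qed
  qed
  then show ?thesis
    using poset by (auto simp: in_rp_iff poset_on_def)
qed

section \<open>Restricted growth functions and set partitions\<close>

definition fibres :: "nat list \<Rightarrow> nat set set" where
  "fibres \<rho> = (\<lambda>i. {j \<in> {1..length \<rho>}. entry \<rho> j = entry \<rho> i}) ` {1..length \<rho>}"

lemma partition_on_fibres: "partition_on {1..length \<rho>} (fibres \<rho>)"
  unfolding partition_on_def disjoint_def fibres_def by auto

lemma fibres_eqD:
  assumes "fibres \<rho> = fibres \<sigma>" "length \<rho> = length \<sigma>"
    and "i \<in> {1..length \<rho>}" "j \<in> {1..length \<rho>}" "entry \<rho> i = entry \<rho> j"
  shows "entry \<sigma> i = entry \<sigma> j"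
proof -
  have "{l \<in> {1..length \<rho>}. entry \<rho> l = entry \<rho> i} \<in> fibres \<sigma>"
    unfolding assms(1)[symmetric] using assms(3) by (auto simp: fibres_def)
  then obtain h where
    "{l \<in> {1..length \<rho>}. entry \<rho> l = entry \<rho> i} = {l \<in> {1..length \<sigma>}. entry \<sigma> l = entry \<sigma> h}"
    unfolding fibres_def by blast
  moreover have "i \<in> {l \<in> {1..length \<rho>}. entry \<rho> l = entry \<rho> i}"
    "j \<in> {l \<in> {1..length \<rho>}. entry \<rho> l = entry \<rho> i}"
    using assms(3-5) by auto
  ultimately show ?thesis by simp
qed

text \<open>
  Suppose two restricted growth functions with the same fibres agree before position \<open>k\<close>. A value
  repeated at \<open>k\<close> in one of them is repeated from the same position in the other; a new value at
  \<open>k\<close> exceeds all earlier ones, hence is the largest one that the growth condition admits.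
\<close>

lemma RGF_entry_le_if_fibres_eq:
  assumes "\<rho> \<in> RGF n" "\<sigma> \<in> RGF n" "fibres \<rho> = fibres \<sigma>" "1 \<le> k" "k \<le> n"
    and agree: "\<And>j. 1 \<le> j \<Longrightarrow> j < k \<Longrightarrow> entry \<rho> j = entry \<sigma> j"
  shows "entry \<sigma> k \<le> entry \<rho> k"
proof (cases "k = 1")
  case True
  then show ?thesis using RGF_first[OF assms(2)] assms(5) by simp
next
  case False
  then obtain m where k: "k = Suc m" "1 \<le> m" using assms(4) by (cases k) auto
  note len = RGF_length[OF assms(1)] RGF_length[OF assms(2)]
  show ?thesis
  proof (cases "entry \<rho> k \<le> max_prefix \<rho> m")
    case True
    then obtain j where j: "1 \<le> j" "j \<le> m" "entry \<rho> j = entry \<rho> k"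
      using RGF_value_occurs[OF assms(1)] k assms(5) by (metis Suc_leD)
    then have "entry \<sigma> j = entry \<sigma> k"
      using k assms(5) len by (intro fibres_eqD[OF assms(3)]) auto
    then show ?thesis using j agree[of j] k by simp
  next
    case False
    have "set (take m \<rho>) = set (take m \<sigma>)"
      using agree k assms(5) len by (auto simp: set_take_eq_entries image_iff)
    then have "max_prefix \<sigma> m = max_prefix \<rho> m" by (simp add: max_prefix_def)
    then show ?thesis using RGF_step[OF assms(2), of m] False k assms(5) by simp
  qed
qed

lemma inj_on_fibres: "inj_on fibres (RGF n)"
proof (rule inj_onI)
  fix \<rho> \<sigma> assume *: "\<rho> \<in> RGF n" "\<sigma> \<in> RGF n" "fibres \<rho> = fibres \<sigma>"
  have "entry \<rho> k = entry \<sigma> k" if "1 \<le> k" "k \<le> n" for k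
    using that
  proof (induction k rule: less_induct)
    case (less k)
    then have agree: "\<And>j. 1 \<le> j \<Longrightarrow> j < k \<Longrightarrow> entry \<rho> j = entry \<sigma> j" by simp
    show ?case
    proof (rule antisym)
      show "entry \<rho> k \<le> entry \<sigma> k"
        by (rule RGF_entry_le_if_fibres_eq[OF *(2,1) *(3)[symmetric] less.prems])
          (simp add: agree)
      show "entry \<sigma> k \<le> entry \<rho> k"
        by (rule RGF_entry_le_if_fibres_eq[OF * less.prems agree])
    qed
  qed
  then show "\<rho> = \<sigma>"
    using *(1,2) by (intro list_eqI_entries) (auto simp: RGF_length)
qed

definition block_rank :: "nat set set \<Rightarrow> nat set \<Rightarrow> nat" where
  "block_rank \<A> B = card {C \<in> \<A>. Min C < Min B}"

lemma block_rank_less: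
  assumes "finite \<A>" "C \<in> \<A>" "Min C < Min B"
  shows "block_rank \<A> C < block_rank \<A> B"
  unfolding block_rank_def using assms by (intro psubset_card_mono) auto

lemma inj_on_block_rank:
  assumes "finite \<A>" "disjoint \<A>" "\<And>B. B \<in> \<A> \<Longrightarrow> finite B \<and> B \<noteq> {}"
  shows "inj_on (block_rank \<A>) \<A>"
proof (rule inj_onI)
  fix B C assume BC: "B \<in> \<A>" "C \<in> \<A>" "block_rank \<A> B = block_rank \<A> C"
  then have "Min B = Min C"
    using block_rank_less[OF assms(1)] by (metis less_irrefl linorder_neqE)
  then have "Min B \<in> B \<inter> C" using assms(3) BC(1,2) by (metis IntI Min_in)
  then show "B = C" using assms(2) BC(1,2) unfolding disjoint_def by blast
qed

text \<open>The witness \<open>C\<close> is the block with the largest minimum among those with a smaller minimum.\<close>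

lemma block_rank_predecessor:
  assumes "finite \<A>" "disjoint \<A>" "\<And>B. B \<in> \<A> \<Longrightarrow> finite B \<and> B \<noteq> {}"
    and "B \<in> \<A>" "block_rank \<A> B > 0"
  obtains C where "C \<in> \<A>" "Min C < Min B" "block_rank \<A> B = Suc (block_rank \<A> C)"
proof -
  let ?D = "{C \<in> \<A>. Min C < Min B}"
  have fin: "finite ?D" using assms(1) by simp
  have "?D \<noteq> {}" using assms(5) unfolding block_rank_def by (metis card.empty less_irrefl)
  then have "Max (Min ` ?D) \<in> Min ` ?D" using fin by (intro Max_in) auto
  then obtain C where C: "C \<in> ?D" "Min C = Max (Min ` ?D)" by auto
  have largest: "Min C' \<le> Min C" if "C' \<in> ?D" for C' using that fin C(2) by simp
  have "C' = C" if "C' \<in> ?D" "\<not> Min C' < Min C" for C'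
  proof -
    have "Min C' = Min C" using largest[OF that(1)] that(2) by simp
    then have "Min C \<in> C' \<inter> C" using that(1) C(1) assms(3) by (metis (no_types, lifting) IntI Min_in mem_Collect_eq)
    then show ?thesis using assms(2) that(1) C(1) unfolding disjoint_def by blast
  qed
  then have "?D = insert C {C' \<in> \<A>. Min C' < Min C}" using C(1) by fastforce
  then have "card ?D = Suc (card {C' \<in> \<A>. Min C' < Min C})" using assms(1) by simp
  then show thesis using that C(1) by (auto simp: block_rank_def)
qed

text \<open>
  Labelling each position with the rank of its block gives a restricted growth function, since the
  preceding block has an element, namely its minimum, to the left of everything in this block.
\<close>

lemma fibres_surj:
  assumes "partition_on {1..n} \<A>"
  shows "\<exists>\<rho> \<in> RGF n. fibres \<rho> = \<A>"
proof -
  have fin: "finite \<A>" using finite_elements[OF _ assms] by simp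
  have disj: "disjoint \<A>" and un: "\<Union>\<A> = {1..n}" using assms by (auto simp: partition_on_def)
  have blk: "finite B \<and> B \<noteq> {}" if "B \<in> \<A>" for B
    using that assms by (metis Union_upper finite_atLeastAtMost finite_subset partition_onD1 partition_onD3)
  define b where "b i = (THE B. B \<in> \<A> \<and> i \<in> B)" for i
  have b: "b i = B" if "B \<in> \<A>" "i \<in> B" for B i
    unfolding b_def using that disj unfolding disjoint_def by (intro the_equality) blast+
  have b_in: "b i \<in> \<A>" "i \<in> b i" if "i \<in> {1..n}" for i
    using that un b by (metis UnionE)+
  define \<rho> where "\<rho> = map (\<lambda>i. block_rank \<A> (b (Suc i))) [0..<n]"
  have [simp]: "length \<rho> = n" by (simp add: \<rho>_def)
  have entry: "entry \<rho> i = block_rank \<A> (b i)" if "i \<in> {1..n}" for i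
    using that by (auto simp: entry_def \<rho>_def)
  \<comment> \<open>This gives both defining conditions of a restricted growth function: at \<open>k = 1\<close> no such \<open>j\<close>
    exists, so the entry is \<open>0\<close>, and later \<open>entry \<rho> j\<close> is bounded by the prefix maximum.\<close>
  have earlier: "\<exists>j. 1 \<le> j \<and> j < k \<and> entry \<rho> k = Suc (entry \<rho> j)"
    if k: "k \<in> {1..n}" and pos: "entry \<rho> k > 0" for k
  proof -
    obtain C where C: "C \<in> \<A>" "Min C < Min (b k)" "block_rank \<A> (b k) = Suc (block_rank \<A> C)"
      using block_rank_predecessor[OF fin disj blk b_in(1)[OF k]] pos entry[OF k] by auto
    have "Min C \<in> C" using blk[OF C(1)] by simp
    then have "Min C \<in> {1..n}" "b (Min C) = C" using un C(1) b by auto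
    moreover have "Min (b k) \<le> k" using blk b_in[OF k] by simp
    ultimately show ?thesis using C entry[OF k] entry[of "Min C"] by (intro exI[of _ "Min C"]) auto
  qed
  have "\<rho> \<in> RGF n"
  proof -
    have "entry \<rho> 1 = 0" if "n \<ge> 1" using earlier[of 1] that by fastforce
    moreover have "entry \<rho> (k + 1) \<le> 1 + max_prefix \<rho> k" if k: "1 \<le> k" "k < n" for k
    proof (cases "entry \<rho> (k + 1) = 0")
      case False
      then obtain j where "1 \<le> j" "j \<le> k" "entry \<rho> (k + 1) = Suc (entry \<rho> j)"
        using earlier[of "k + 1"] k by auto
      then show ?thesis using entry_le_max_prefix[of j k \<rho>] k by simp
    qed simp
    ultimately show ?thesis by (auto simp: RGF_def)
  qed
  moreover have "fibres \<rho> = \<A>"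
  proof -
    have fibre: "{j \<in> {1..n}. entry \<rho> j = entry \<rho> i} = b i" if i: "i \<in> {1..n}" for i
    proof -
      have "entry \<rho> j = entry \<rho> i \<longleftrightarrow> b j = b i" if "j \<in> {1..n}" for j
        using inj_onD[OF inj_on_block_rank[OF fin disj blk]] b_in[OF i] b_in[OF that]
          entry[OF i] entry[OF that] by auto
      then have "{j \<in> {1..n}. entry \<rho> j = entry \<rho> i} = {j \<in> {1..n}. b j = b i}" by blast
      also have "\<dots> = b i" using b_in(2) b[OF b_in(1)[OF i]] un b_in(1)[OF i] by blast
      finally show ?thesis .
    qed
    have "fibres \<rho> = b ` {1..n}" unfolding fibres_def \<open>length \<rho> = n\<close>
      by (rule image_cong[OF refl fibre])
    also have "\<dots> = \<A>"
    proof
      show "b ` {1..n} \<subseteq> \<A>" using b_in by auto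
      show "\<A> \<subseteq> b ` {1..n}"
      proof
        fix B assume B: "B \<in> \<A>"
        then obtain i where "i \<in> B" using blk by blast
        then show "B \<in> b ` {1..n}" using B b[OF B] un by blast
      qed
    qed
    finally show ?thesis .
  qed
  ultimately show ?thesis by blast
qed

lemma bij_betw_fibres: "bij_betw fibres (RGF n) {\<A>. partition_on {1..n} \<A>}"
  unfolding bij_betw_def
proof
  have "partition_on {1..n} (fibres \<rho>)" if "\<rho> \<in> RGF n" for \<rho>
    using partition_on_fibres[of \<rho>] RGF_length[OF that] by simp
  then show "fibres ` RGF n = {\<A>. partition_on {1..n} \<A>}"
    using fibres_surj by blast
qed (rule inj_on_fibres)

section \<open>The bijection and the enumeration\<close>

theorem theorem7p4:
  fixes n :: nat
  shows "bij_betw rp (RGF n) (Av_P3 n)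
    \<and> (\<forall>P\<in>Av_P3 n. rp_inv n P \<in> RGF n \<and> rp (rp_inv n P) = P)
    \<and> (\<forall>\<rho>\<in>RGF n. rp_inv n (rp \<rho>) = \<rho>)
    \<and> card (Av_P3 n) = Bell n"
proof -
  have into: "rp \<rho> \<in> Av_P3 n" if "\<rho> \<in> RGF n" for \<rho>
    using rp_in_Av_P3[of \<rho>] RGF_length[OF that] by simp
  have inv_into: "rp_inv n P \<in> RGF n" if "P \<in> Av_P3 n" for P
    using that by (intro rp_inv_in_RGF) (simp add: Av_P3_def)
  have bij: "bij_betw rp (RGF n) (Av_P3 n)"
    by (rule bij_betw_byWitness[of _ "rp_inv n"]) (auto simp: into inv_into rp_inv_rp rp_rp_inv)
  moreover have "card (Av_P3 n) = Bell n"
    using bij_betw_same_card[OF bij] bij_betw_same_card[OF bij_betw_fibres, of n]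
    by (simp add: Bell_def)
  ultimately show ?thesis by (simp add: inv_into rp_inv_rp rp_rp_inv)
qed

end
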